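(* For every differential hybrid game $\alpha$ and every dGL formula $\phi$, the formula $\lnot\langle\alpha\rangle\lnot\phi \leftrightarrow [\alpha]\phi$ is valid (true in every state). Equivalently, for every set of states $X$, the complement of $\varsigma_\alpha(\overline{X})$ equals $\delta_\alpha(X)$, where $\overline{X}$ denotes the complement of $X$.
   Context: Differential game logic (dGL). Terms are polynomials with real coefficients in real-valued variables. Differential hybrid games are generated by $\alpha,\beta ::= (x'=f(x,y,z)\ \&\ y\in Y\ \&\ z\in Z) \mid x:=\theta \mid ?\psi \mid \alpha\cup\beta \mid \alpha;\beta \mid \alpha^* \mid \alpha^d$, where $x$ is a vector of variables, $f(x,y,z)$ a vector of terms of the same dimension, $y\in Y$ and $z\in Z$ are first-order real-arithmetic formulas whose only free variables are $y$ resp. $z$, and $\psi$ is a dGL formula. Formulas: $\phi,\psi ::= \theta_1\ge\theta_2 \mid \lnot\phi \mid \phi\land\psi \mid \exists x\,\phi \mid \langle\alpha\rangle\phi \mid [\alpha]\phi$. A state $\omega$ maps variables to reals; $[\![\phi]\!]$ is the set of states where $\phi$ is true, with the usual clauses for arithmetic, connectives and quantifiers, and $[\![\langle\alpha\rangle\phi]\!]=\varsigma_\alpha([\![\phi]\!])$, $[\![[\alpha]\phi]\!]=\delta_\alpha([\![\phi]\!])$. For a set of states $X$ (complement $\overline X$): $\varsigma_{x:=\theta}(X)=\delta_{x:=\theta}(X)=\{\omega : \omega[x\mapsto\omega(\theta)]\in X\}$; $\varsigma_{?\psi}(X)=[\![\psi]\!]\cap X$, $\delta_{?\psi}(X)=\overline{[\![\psi]\!]}\cup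 X$; $\varsigma_{\alpha\cup\beta}(X)=\varsigma_\alpha(X)\cup\varsigma_\beta(X)$, $\delta_{\alpha\cup\beta}(X)=\delta_\alpha(X)\cap\delta_\beta(X)$; $\varsigma_{\alpha;\beta}(X)=\varsigma_\alpha(\varsigma_\beta(X))$, $\delta_{\alpha;\beta}(X)=\delta_\alpha(\delta_\beta(X))$; $\varsigma_{\alpha^*}(X)=\bigcap\{Z : X\cup\varsigma_\alpha(Z)\subseteq Z\}$, $\delta_{\alpha^*}(X)=\bigcup\{Z : Z\subseteq X\cap\delta_\alpha(Z)\}$; $\varsigma_{\alpha^d}(X)=\overline{\varsigma_\alpha(\overline X)}$, $\delta_{\alpha^d}(X)=\overline{\delta_\alpha(\overline X)}$. For the differential game $D\equiv(x'=f(x,y,z)\ \&\ y\in Y\ \&\ z\in Z)$: for $T\ge0$ let $\mathcal M_Y$ (resp. $\mathcal M_Z$) be the measurable functions $[0,T]\to Y$ (resp. $\to Z$), identifying sets with the sets of values satisfying the formulas; a nonanticipative strategy is $\beta:\mathcal M_Y\to\mathcal M_Z$ such that for all $s\in[0,T]$, if $y=\hat y$ a.e. on $[0,s]$ then $\beta(y)=\beta(\hat y)$ a.e. on $[0,s]$; $\Delta_Z$ is the set of such strategies. For $y\in\mathcal M_Y,z\in\mathcal M_Z$, the response $x^{y,z}_\omega(\zeta)$ is the state equal to $\omega$ except that $x$ has the value at time $\zeta$ of the unique Carathéodory solution (absolutely continuous, satisfying the ODE almost everywhere) of $x'(s)=f(x(s),y(s),z(s))$, $x(0)=\omega(x)$.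 Then $\varsigma_D(X)=\{\omega : \exists T\ge0\,\exists\beta\in\Delta_Z\,\forall y\in\mathcal M_Y\,\exists\zeta\in[0,T]\ x^{y,\beta(y)}_\omega(\zeta)\in X\}$ and $\delta_D(X)=\{\omega : \forall T\ge0\,\forall\beta\in\Delta_Z\,\exists y\in\mathcal M_Y\,\forall\zeta\in[0,T]\ x^{y,\beta(y)}_\omega(\zeta)\in X\}$. Standing assumption: in every differential game the sets defined by $y\in Y$, $z\in Z$ are compact and $f$ is bounded, so responses exist and are unique. A formula is valid if true in all states. *)

theory Defs
  imports "HOL-Analysis.Analysis"
begin

section \<open>Syntax\<close>

type_synonym var = string

type_synonym state = "var \<Rightarrow> real"

datatype trm =
    Var var
  | Const real
  | Plus trm trm
  | Times trm trm

datatype fo_fml =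
    FO_Geq trm trm
  | FO_Not fo_fml
  | FO_And fo_fml fo_fml
  | FO_Exists var fo_fml

text \<open>In \<open>DGame ode ys Y zs Z\<close>, the list \<open>ode\<close> pairs each component of the vector \<open>x\<close> with
  the corresponding component of \<open>f(x,y,z)\<close>; the control vectors \<open>y\<close> and \<open>z\<close> are given by
  the lists \<open>ys\<close> and \<open>zs\<close> of their component variables.\<close>

datatype fml =
    Geq trm trm
  | Neg fml
  | And fml fml
  | Exists var fml
  | Diamond game fml
  | Box game fml
and game =
    DGame "(var \<times> trm) list" "var list" fo_fml "var list" fo_fml
  | Assign var trm
  | Test fml
  | Choice game game
  | Seq game game
  | Loop game
  | Dual game

definition Implies :: "fml \<Rightarrow> fml \<Rightarrow> fml" where
  "Implies \<phi> \<psi> = Neg (And \<phi> (Neg \<psi>))"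

definition Equiv :: "fml \<Rightarrow> fml \<Rightarrow> fml" where
  "Equiv \<phi> \<psi> = And (Implies \<phi> \<psi>) (Implies \<psi> \<phi>)"

primrec FV_trm :: "trm \<Rightarrow> var set" where
  "FV_trm (Var x) = {x}"
| "FV_trm (Const c) = {}"
| "FV_trm (Plus \<theta> \<eta>) = FV_trm \<theta> \<union> FV_trm \<eta>"
| "FV_trm (Times \<theta> \<eta>) = FV_trm \<theta> \<union> FV_trm \<eta>"

primrec FV_fo :: "fo_fml \<Rightarrow> var set" where
  "FV_fo (FO_Geq \<theta> \<eta>) = FV_trm \<theta> \<union> FV_trm \<eta>"
| "FV_fo (FO_Not P) = FV_fo P"
| "FV_fo (FO_And P Q) = FV_fo P \<union> FV_fo Q"
| "FV_fo (FO_Exists x P) = FV_fo P - {x}"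


section \<open>Arithmetic semantics\<close>

primrec trm_val :: "trm \<Rightarrow> state \<Rightarrow> real" where
  "trm_val (Var x) \<sigma> = \<sigma> x"
| "trm_val (Const c) \<sigma> = c"
| "trm_val (Plus \<theta> \<eta>) \<sigma> = trm_val \<theta> \<sigma> + trm_val \<eta> \<sigma>"
| "trm_val (Times \<theta> \<eta>) \<sigma> = trm_val \<theta> \<sigma> * trm_val \<eta> \<sigma>"

primrec fo_sem :: "fo_fml \<Rightarrow> state set" where
  "fo_sem (FO_Geq \<theta> \<eta>) = {\<sigma>. trm_val \<theta> \<sigma> \<ge> trm_val \<eta> \<sigma>}"
| "fo_sem (FO_Not P) = - fo_sem P"
| "fo_sem (FO_And P Q) = fo_sem P \<inter> fo_sem Q"
| "fo_sem (FO_Exists x P) = {\<sigma>. \<exists>r. \<sigma>(x := r) \<in> fo_sem P}"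


section \<open>Differential games\<close>

text \<open>Values of a vector of variables are represented as functions that are extensional on
  the set of its component variables.\<close>

definition control_set :: "var list \<Rightarrow> fo_fml \<Rightarrow> (var \<Rightarrow> real) set" where
  "control_set ys Y = (\<lambda>\<sigma>. restrict \<sigma> (set ys)) ` fo_sem Y"

definition controls :: "real \<Rightarrow> var list \<Rightarrow> fo_fml \<Rightarrow> (real \<Rightarrow> var \<Rightarrow> real) set" where
  "controls T ys Y =
     {u \<in> {0..T} \<rightarrow>\<^sub>E control_set ys Y.
        u \<in> lebesgue_on {0..T} \<rightarrow>\<^sub>M (\<Pi>\<^sub>M v\<in>set ys. borel)}"

definition strategies ::
  "real \<Rightarrow> var list \<Rightarrow> fo_fml \<Rightarrow> var list \<Rightarrow> fo_fml
    \<Rightarrow> ((real \<Rightarrow> var \<Rightarrow> real) \<Rightarrow> (real \<Rightarrow> var \<Rightarrow> real)) set" where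
  "strategies T ys Y zs Z =
     {\<beta> \<in> controls T ys Y \<rightarrow>\<^sub>E controls T zs Z.
        \<forall>s\<in>{0..T}. \<forall>y\<in>controls T ys Y. \<forall>y'\<in>controls T ys Y.
          (AE t in lebesgue_on {0..s}. y t = y' t) \<longrightarrow>
          (AE t in lebesgue_on {0..s}. \<beta> y t = \<beta> y' t)}"

definition abs_continuous_on :: "real \<Rightarrow> real \<Rightarrow> (real \<Rightarrow> real) \<Rightarrow> bool" where
  "abs_continuous_on c d g \<longleftrightarrow>
     (\<forall>\<epsilon>>0. \<exists>\<delta>>0. \<forall>(n::nat) (a::nat \<Rightarrow> real) (b::nat \<Rightarrow> real).
        (\<forall>i<n. c \<le> a i \<and> a i \<le> b i \<and> b i \<le> d) \<and>
        (\<forall>i<n. \<forall>j<n. i \<noteq> j \<longrightarrow> {a i<..<b i} \<inter> {a j<..<b j} = {}) \<and>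
        (\<Sum>i<n. b i - a i) < \<delta> \<longrightarrow>
        (\<Sum>i<n. \<bar>g (b i) - g (a i)\<bar>) < \<epsilon>)"

abbreviation ode_vars :: "(var \<times> trm) list \<Rightarrow> var set" where
  "ode_vars ode \<equiv> fst ` set ode"

text \<open>Extensionality on \<open>[0, T]\<close> and on the variables of \<open>x\<close> makes the solution unique as a
  HOL function. Variables other than those of \<open>x\<close>, \<open>y\<close>, \<open>z\<close> keep their value in \<open>\<sigma>\<close>.\<close>

definition caratheodory_solution ::
  "(var \<times> trm) list \<Rightarrow> var list \<Rightarrow> var list \<Rightarrow> real \<Rightarrow> state
    \<Rightarrow> (real \<Rightarrow> var \<Rightarrow> real) \<Rightarrow> (real \<Rightarrow> var \<Rightarrow> real) \<Rightarrow> (real \<Rightarrow> var \<Rightarrow> real) \<Rightarrow> bool" where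
  "caratheodory_solution ode ys zs T \<sigma> y z x \<longleftrightarrow>
     x \<in> {0..T} \<rightarrow>\<^sub>E (ode_vars ode \<rightarrow>\<^sub>E UNIV) \<and>
     (\<forall>v\<in>ode_vars ode. x 0 v = \<sigma> v) \<and>
     (\<forall>v\<in>ode_vars ode. abs_continuous_on 0 T (\<lambda>t. x t v)) \<and>
     (AE t in lebesgue_on {0..T}. \<forall>(v, \<theta>)\<in>set ode.
        ((\<lambda>s. x s v) has_real_derivative
          trm_val \<theta> (override_on (override_on (override_on \<sigma> (x t) (ode_vars ode))
                       (y t) (set ys)) (z t) (set zs)))
        (at t within {0..T}))"

definition response ::
  "(var \<times> trm) list \<Rightarrow> var list \<Rightarrow> var list \<Rightarrow> real \<Rightarrow> state
    \<Rightarrow> (real \<Rightarrow> var \<Rightarrow> real) \<Rightarrow> (real \<Rightarrow> var \<Rightarrow> real) \<Rightarrow> real \<Rightarrow> state" where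
  "response ode ys zs T \<sigma> y z \<zeta> =
     override_on \<sigma> ((THE x. caratheodory_solution ode ys zs T \<sigma> y z x) \<zeta>) (ode_vars ode)"

definition dgame_angel ::
  "(var \<times> trm) list \<Rightarrow> var list \<Rightarrow> fo_fml \<Rightarrow> var list \<Rightarrow> fo_fml \<Rightarrow> state set \<Rightarrow> state set" where
  "dgame_angel ode ys Y zs Z X =
     {\<sigma>. \<exists>T\<ge>0. \<exists>\<beta>\<in>strategies T ys Y zs Z. \<forall>y\<in>controls T ys Y. \<exists>\<zeta>\<in>{0..T}.
        response ode ys zs T \<sigma> y (\<beta> y) \<zeta> \<in> X}"

definition dgame_demon ::
  "(var \<times> trm) list \<Rightarrow> var list \<Rightarrow> fo_fml \<Rightarrow> var list \<Rightarrow> fo_fml \<Rightarrow> state set \<Rightarrow> state set" where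
  "dgame_demon ode ys Y zs Z X =
     {\<sigma>. \<forall>T\<ge>0. \<forall>\<beta>\<in>strategies T ys Y zs Z. \<exists>y\<in>controls T ys Y. \<forall>\<zeta>\<in>{0..T}.
        response ode ys zs T \<sigma> y (\<beta> y) \<zeta> \<in> X}"


section \<open>Semantics of formulas and games\<close>

fun sem :: "fml \<Rightarrow> state set"
  and angel :: "game \<Rightarrow> state set \<Rightarrow> state set"
  and demon :: "game \<Rightarrow> state set \<Rightarrow> state set" where
  "sem (Geq \<theta> \<eta>) = {\<sigma>. trm_val \<theta> \<sigma> \<ge> trm_val \<eta> \<sigma>}"
| "sem (Neg \<phi>) = - sem \<phi>"
| "sem (And \<phi> \<psi>) = sem \<phi> \<inter> sem \<psi>"
| "sem (Exists x \<phi>) = {\<sigma>. \<exists>r. \<sigma>(x := r) \<in> sem \<phi>}"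
| "sem (Diamond \<alpha> \<phi>) = angel \<alpha> (sem \<phi>)"
| "sem (Box \<alpha> \<phi>) = demon \<alpha> (sem \<phi>)"
| "angel (DGame ode ys Y zs Z) X = dgame_angel ode ys Y zs Z X"
| "angel (Assign x \<theta>) X = {\<sigma>. \<sigma>(x := trm_val \<theta> \<sigma>) \<in> X}"
| "angel (Test \<psi>) X = sem \<psi> \<inter> X"
| "angel (Choice \<alpha> \<beta>) X = angel \<alpha> X \<union> angel \<beta> X"
| "angel (Seq \<alpha> \<beta>) X = angel \<alpha> (angel \<beta> X)"
| "angel (Loop \<alpha>) X = \<Inter> {S. X \<union> angel \<alpha> S \<subseteq> S}"
| "angel (Dual \<alpha>) X = - angel \<alpha> (- X)"
| "demon (DGame ode ys Y zs Z) X = dgame_demon ode ys Y zs Z X"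
| "demon (Assign x \<theta>) X = {\<sigma>. \<sigma>(x := trm_val \<theta> \<sigma>) \<in> X}"
| "demon (Test \<psi>) X = - sem \<psi> \<union> X"
| "demon (Choice \<alpha> \<beta>) X = demon \<alpha> X \<inter> demon \<beta> X"
| "demon (Seq \<alpha> \<beta>) X = demon \<alpha> (demon \<beta> X)"
| "demon (Loop \<alpha>) X = \<Union> {S. S \<subseteq> X \<inter> demon \<alpha> S}"
| "demon (Dual \<alpha>) X = - demon \<alpha> (- X)"

definition valid :: "fml \<Rightarrow> bool" where
  "valid \<phi> \<longleftrightarrow> (\<forall>\<sigma>. \<sigma> \<in> sem \<phi>)"


section \<open>Well-formedness and standing assumptions\<close>

text \<open>The last conjunct says that \<open>f\<close> is bounded on all \<open>x\<close> and all \<open>y \<in> Y\<close>, \<open>z \<in> Z\<close>; any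
  further variables occurring in \<open>f\<close> are parameters, held fixed at their value in \<open>\<sigma>\<close>.\<close>

definition wf_dgame ::
  "(var \<times> trm) list \<Rightarrow> var list \<Rightarrow> fo_fml \<Rightarrow> var list \<Rightarrow> fo_fml \<Rightarrow> bool" where
  "wf_dgame ode ys Y zs Z \<longleftrightarrow>
     distinct (map fst ode @ ys @ zs) \<and>
     FV_fo Y \<subseteq> set ys \<and> FV_fo Z \<subseteq> set zs \<and>
     compactin (powertop_real (set ys)) (control_set ys Y) \<and>
     compactin (powertop_real (set zs)) (control_set zs Z) \<and>
     (\<forall>\<sigma>. \<forall>(v, \<theta>)\<in>set ode.
        bounded (trm_val \<theta> ` {\<nu> \<in> fo_sem Y \<inter> fo_sem Z.
          \<forall>u. u \<notin> ode_vars ode \<union> set ys \<union> set zs \<longrightarrow> \<nu> u = \<sigma> u}))"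

primrec wf_fml :: "fml \<Rightarrow> bool" and wf_game :: "game \<Rightarrow> bool" where
  "wf_fml (Geq \<theta> \<eta>) \<longleftrightarrow> True"
| "wf_fml (Neg \<phi>) \<longleftrightarrow> wf_fml \<phi>"
| "wf_fml (And \<phi> \<psi>) \<longleftrightarrow> wf_fml \<phi> \<and> wf_fml \<psi>"
| "wf_fml (Exists x \<phi>) \<longleftrightarrow> wf_fml \<phi>"
| "wf_fml (Diamond \<alpha> \<phi>) \<longleftrightarrow> wf_game \<alpha> \<and> wf_fml \<phi>"
| "wf_fml (Box \<alpha> \<phi>) \<longleftrightarrow> wf_game \<alpha> \<and> wf_fml \<phi>"
| "wf_game (DGame ode ys Y zs Z) \<longleftrightarrow> wf_dgame ode ys Y zs Z"
| "wf_game (Assign x \<theta>) \<longleftrightarrow> True"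
| "wf_game (Test \<psi>) \<longleftrightarrow> wf_fml \<psi>"
| "wf_game (Choice \<alpha> \<beta>) \<longleftrightarrow> wf_game \<alpha> \<and> wf_game \<beta>"
| "wf_game (Seq \<alpha> \<beta>) \<longleftrightarrow> wf_game \<alpha> \<and> wf_game \<beta>"
| "wf_game (Loop \<alpha>) \<longleftrightarrow> wf_game \<alpha>"
| "wf_game (Dual \<alpha>) \<longleftrightarrow> wf_game \<alpha>"

end

theory Submission
  imports Defs
begin

text \<open>Structural induction on the game, for all \<open>X\<close> at once. For differential
  games both regions quantify over the same strategies, with dual quantifier prefixes, so negation
  suffices. Loops need the duality of least and greatest fixpoints,
  \<open>Compl_Inter_prefixpoints\<close>; the other cases are De Morgan laws.\<close>

lemma Compl_dgame_angel: "- dgame_angel ode ys Y zs Z (- X) = dgame_demon ode ys Y zs Z X"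
  unfolding dgame_angel_def dgame_demon_def by (simp add: set_eq_iff)

text \<open>Mapping S to its complement exchanges the sets closed under one operator with the sets
  contained in their image under the other.\<close>

lemma Compl_Inter_prefixpoints:
  assumes "\<And>S. - F (- S) = G S"
  shows "- \<Inter> {S. - X \<union> F S \<subseteq> S} = \<Union> {S. S \<subseteq> X \<inter> G S}" (is "?L = ?R")
proof
  show "?L \<subseteq> ?R"
  proof
    fix \<sigma> assume "\<sigma> \<in> ?L"
    then obtain S where S: "- X \<union> F S \<subseteq> S" "\<sigma> \<in> - S" by auto
    have "- S \<subseteq> X \<inter> G (- S)" using S(1) assms[of "- S"] by auto
    with S(2) show "\<sigma> \<in> ?R" by blast
  qed
  show "?R \<subseteq> ?L"
  proof
    fix \<sigma> assume "\<sigma> \<in> ?R"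
    then obtain S where S: "S \<subseteq> X \<inter> G S" "\<sigma> \<in> S" by auto
    have "- X \<union> F (- S) \<subseteq> - S" using S(1) assms[of S] by auto
    with S(2) show "\<sigma> \<in> ?L" by blast
  qed
qed

lemma Compl_angel: "- angel \<alpha> (- X) = demon \<alpha> X"
\<comment> \<open>Formulas get a trivial predicate: a test uses the same \<open>sem \<psi>\<close>
  for both players.\<close>
proof (induction \<alpha> arbitrary: X rule: game.induct[where ?P1.0 = "\<lambda>_. True"])
  case (Seq \<alpha> \<beta>)
  \<comment> \<open>Rewrites the inner region as a complement, the form the hypothesis for
    \<open>\<alpha>\<close> expects.\<close>
  have "angel \<beta> (- X) = - demon \<beta> X" using Seq.IH(2)[of X] by auto
  then show ?case using Seq.IH(1) by simp
next
  case (Loop \<alpha>)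
  then show ?case by (simp only: angel.simps demon.simps Compl_Inter_prefixpoints)
next
  case (Dual \<alpha>)
  then show ?case using Dual.IH[of "- X"] by auto
qed (auto simp: Compl_dgame_angel)

theorem theorem3p8:
  fixes \<alpha> :: game
  assumes "wf_game \<alpha>"
  shows "(\<forall>\<phi>. wf_fml \<phi> \<longrightarrow> valid (Equiv (Neg (Diamond \<alpha> (Neg \<phi>))) (Box \<alpha> \<phi>)))
       \<and> (\<forall>X :: state set. - angel \<alpha> (- X) = demon \<alpha> X)"
  by (simp add: Compl_angel valid_def Equiv_def Implies_def)

end
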